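(* Let $-\infty<L<R<\infty$ and let $p:\mathbb{R}\to[0,\infty)$ be a probability density function with support $[L,R]$ and distribution function $P$, satisfying the following conditions. (i) $p$ is continuous and positive on $(L,R)$, and there are finitely many points $L<y_1<\dots<y_m<R$ ($m\ge 0$) such that $p$ is continuously differentiable on each component interval of $S(p)=(L,R)\setminus\{y_1,\dots,y_m\}$. (ii) $\sup_{x\in S(p)}\left|\frac{p'(x)\min\{P(x),1-P(x)\}}{p^2(x)}\right|<\infty$. (iii) $\int_{S(p)}(1+|x|)\,|p'(x)|\,\mathrm{d}x<\infty$. (iv) $\lim_{x\searrow L}\frac{P(x)}{p(x)}=0$. (v) $\lim_{x\nearrow R}\frac{1-P(x)}{p(x)}=0$. Assume that the limit $\lim_{x\nearrow R}p(x)$ exists. Let $X:\Omega\to(L,R)$ be a random variable that has a Lebesgue density, with $\mathbb{E}\left|\frac{p'(X)}{p(X)}\right|<\infty$. Then $X$ has Lebesgue density $p$ if, and only if, the density function $\mathfrak{f}_X$ of $X$ (for a suitable version) satisfies $$\mathfrak{f}_X(t)=\mathbb{E}\left[-\frac{p'(X)}{p(X)}\,\mathbf{1}\{X>t\}\right]+\lim_{x\nearrow R}p(x),\quad L<t<R.$$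
   Context: $(\Omega,\mathcal{A},\mathbb{P})$ is a probability space and $\mathbf{1}\{\cdot\}$ denotes an indicator. "$X$ has Lebesgue density $p$" means that the law of $X$ is $p\,\mathcal{L}^1$, where $\mathcal{L}^1$ is Lebesgue measure on $\mathbb{R}$. $P(x)=\int_{L}^x p(s)\,\mathrm{d}s$ for $x\in[L,R]$. The case $m=0$ is allowed. "The limit exists" means that it exists as a (finite) real number. Densities are unique only up to $\mathcal{L}^1$-null sets; "for a suitable version" means that the function on the right-hand side is (on $(L,R)$) a density function of $X$. *)

theory Defs
  imports "HOL-Probability.Probability"
begin

definition prob_density :: "(real \<Rightarrow> real) \<Rightarrow> bool" where
  "prob_density p \<longleftrightarrow>
     p \<in> borel_measurable borel \<and> (\<forall>x. 0 \<le> p x) \<and> (\<integral>\<^sup>+x. ennreal (p x) \<partial>lborel) = 1"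

definition dens_support :: "(real \<Rightarrow> real) \<Rightarrow> real set" where
  "dens_support p = closure {x. p x \<noteq> 0}"

text \<open>Only used for \<open>L \<le> x \<le> R\<close>, where \<open>[L, R]\<close> is the support of \<open>p\<close>; there it is the
  distribution function of \<open>p\<close>.\<close>

definition dist_fun :: "(real \<Rightarrow> real) \<Rightarrow> real \<Rightarrow> real \<Rightarrow> real" where
  "dist_fun p L x = (LBINT s:{L..x}. p s)"

text \<open>Nonnegativity is required separately because \<^const>\<open>ennreal\<close> maps negative reals to 0, so
  that \<^const>\<open>distributed\<close> alone would not see negative values of \<open>f\<close>.\<close>

definition has_lebesgue_density :: "'a measure \<Rightarrow> ('a \<Rightarrow> real) \<Rightarrow> (real \<Rightarrow> real) \<Rightarrow> bool" where
  "has_lebesgue_density M X f \<longleftrightarrow>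
     (\<forall>x. 0 \<le> f x) \<and> distributed M lborel X (\<lambda>x. ennreal (f x))"

end

theory Submission
  imports Defs
begin

text \<open>
  If \<open>X\<close> takes values in \<open>(L, R)\<close> and has density \<open>f\<close>, then
  \<open>E [- p'(X) / p(X) * 1{X > t}]\<close> is \<open>- \<integral> p' / p * f\<close> over \<open>(t, R)\<close>, so the claimed formula is the integral
  equation
    \<open>f t = l - (\<integral> x \<in> (t, R). p' x / p x * f x)\<close>   with   \<open>l = lim p\<close> at \<open>R\<close>.
  This is the integrated form, with final value \<open>l\<close>, of the linear equation \<open>f' = (p' / p) f\<close>,
  whose solutions are the multiples of \<open>p\<close>.

  If \<open>X\<close> has density \<open>p\<close>, the choice \<open>f = p\<close> reduces the integral equation to the fundamental
  theorem of calculus for \<open>p\<close> on \<open>(t, R)\<close>; the finitely many points without derivative are harmless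
  because \<open>p\<close> is continuous there, and \<open>l\<close> appears as the continuous extension of \<open>p\<close> to \<open>R\<close>
  (\<open>integral_deriv_eq_left_limit_diff\<close>).

  Conversely, for a density \<open>f\<close> that satisfies the equation, \<open>f / p\<close> is continuous on \<open>(L, R)\<close> with
  derivative zero off finitely many points, hence constant
  (\<open>log_derivative_integral_equation_proportional\<close>).  Both \<open>f\<close> and \<open>p\<close> have total mass one and
  vanish almost everywhere outside \<open>(L, R)\<close>, so the constant is one
  (\<open>density_proportional_to_prob_density\<close>).
\<close>

section \<open>Expectations of a random variable with values in an interval\<close>

lemma distributed_AE_iff:
  assumes D: "distributed M N X f" and P: "{x \<in> space N. P x} \<in> sets N"
  shows "(AE \<omega> in M. P (X \<omega>)) \<longleftrightarrow> (AE x in N. 0 < f x \<longrightarrow> P x)"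
proof -
  have "(AE \<omega> in M. P (X \<omega>)) \<longleftrightarrow> (AE x in distr M N X. P x)"
    using AE_distr_iff[OF distributed_measurable[OF D] P] by simp
  also have "\<dots> \<longleftrightarrow> (AE x in density N f. P x)"
    by (simp only: distributed_distr_eq_density[OF D])
  also have "\<dots> \<longleftrightarrow> (AE x in N. 0 < f x \<longrightarrow> P x)"
    by (rule AE_density[OF distributed_borel_measurable[OF D]])
  finally show ?thesis .
qed

text \<open>A function such as \<open>p' / p\<close> is only piecewise continuous on \<open>I\<close> and takes arbitrary values outside
  it, so measurability is asked of its restriction to \<open>I\<close> alone; this suffices because \<open>X\<close> stays
  in \<open>I\<close>.\<close>

lemma
  fixes r f :: "real \<Rightarrow> real" and X :: "'a \<Rightarrow> real"
  assumes D: "has_lebesgue_density M X f"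
    and I: "I \<in> sets borel" and XI: "\<And>\<omega>. \<omega> \<in> space M \<Longrightarrow> X \<omega> \<in> I"
    and r: "(\<lambda>x. indicator I x * r x) \<in> borel_measurable borel"
    and int: "integrable M (\<lambda>\<omega>. \<bar>r (X \<omega>)\<bar>)"
  shows set_integrable_times_density: "set_integrable lborel I (\<lambda>x. r x * f x)"
    and expectation_beyond_eq_integral:
      "(\<integral>\<omega>. - r (X \<omega>) * indicator {t<..} (X \<omega>) \<partial>M) = - (LBINT x:I \<inter> {t<..}. r x * f x)"
proof -
  define q where "q x = indicator I x * r x" for x
  have q [measurable]: "q \<in> borel_measurable borel"
    using r by (simp add: q_def[abs_def])
  have f0: "0 \<le> f x" and D': "distributed M lborel X (\<lambda>x. ennreal (f x))" for x
    using D by (auto simp: has_lebesgue_density_def)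
  have X [measurable]: "X \<in> borel_measurable M"
    using distributed_measurable[OF D'] by simp
  have qX: "q (X \<omega>) = r (X \<omega>)" if "\<omega> \<in> space M" for \<omega>
    using XI[OF that] by (simp add: q_def)
  have "integrable M (\<lambda>\<omega>. q (X \<omega>))"
    by (rule Bochner_Integration.integrable_bound[OF int]) (auto simp: qX)
  then have "integrable lborel (\<lambda>x. f x * q x)"
    using distributed_integrable[OF D', of q] f0 by simp
  then show "set_integrable lborel I (\<lambda>x. r x * f x)"
    by (simp add: set_integrable_def q_def mult_ac)
  have "(\<integral>\<omega>. - r (X \<omega>) * indicator {t<..} (X \<omega>) \<partial>M)
      = (\<integral>\<omega>. - (q (X \<omega>) * indicator {t<..} (X \<omega>)) \<partial>M)"
    by (rule Bochner_Integration.integral_cong) (simp_all add: qX)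
  also have "\<dots> = - (\<integral>\<omega>. q (X \<omega>) * indicator {t<..} (X \<omega>) \<partial>M)"
    by simp
  also have "(\<integral>\<omega>. q (X \<omega>) * indicator {t<..} (X \<omega>) \<partial>M) = (\<integral>x. f x * (q x * indicator {t<..} x) \<partial>lborel)"
    using distributed_integral[OF D', of "\<lambda>x. q x * indicator {t<..} x"] f0 by simp
  also have "\<dots> = (LBINT x:I \<inter> {t<..}. r x * f x)"
    unfolding set_lebesgue_integral_def
    by (rule Bochner_Integration.integral_cong) (auto simp: q_def indicator_def)
  finally show "(\<integral>\<omega>. - r (X \<omega>) * indicator {t<..} (X \<omega>) \<partial>M) = - (LBINT x:I \<inter> {t<..}. r x * f x)" .
qed

section \<open>The fundamental theorem of calculus up to the right endpoint\<close>

text \<open>Only a limit of \<open>p\<close> at \<open>R\<close> is given, so the fundamental theorem of calculus is applied to the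
  continuous extension \<open>q\<close> of \<open>p\<close> to \<open>[t, R]\<close>.\<close>

lemma integral_deriv_eq_left_limit_diff:
  fixes p p' :: "real \<Rightarrow> real"
  assumes "finite Y" "t < R" and cont: "continuous_on {t..<R} p"
    and deriv: "\<And>x. x \<in> {t<..<R} - Y \<Longrightarrow> (p has_real_derivative p' x) (at x)"
    and lim: "(p \<longlongrightarrow> l) (at_left R)"
    and int: "set_integrable lborel {t<..<R} p'"
  shows "(LBINT x:{t<..<R}. p' x) = l - p t"
proof -
  define q where "q x = (if x < R then p x else l)" for x
  have "(p' has_integral q R - q t) {t..R}"
  proof (rule fundamental_theorem_of_calculus_interior_strong[OF \<open>finite Y\<close>])
    show "continuous_on {t..R} q"
      unfolding continuous_on_def
    proof
      fix x assume x: "x \<in> {t..R}"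
      show "(q \<longlongrightarrow> q x) (at x within {t..R})"
      proof (cases "x = R")
        case True
        have "(q \<longlongrightarrow> l) (at_left R)"
          by (rule Lim_transform_eventually[OF lim]) (simp add: eventually_at_filter q_def)
        then show ?thesis
          using True \<open>t < R\<close> by (simp add: at_within_Icc_at_left q_def)
      next
        case False
        with x have "x < R" "t \<le> x" by auto
        have "(p \<longlongrightarrow> p x) (at x within {t..<R})"
          using cont \<open>x < R\<close> \<open>t \<le> x\<close> by (simp add: continuous_on_def)
        moreover have "at x within {t..<R} = at x within {t..R}"
          by (rule at_within_nhd[of x "{..<R}"]) (use \<open>x < R\<close> in auto)
        ultimately have "(p \<longlongrightarrow> q x) (at x within {t..R})"
          using \<open>x < R\<close> by (simp add: q_def)
        moreover have "\<forall>\<^sub>F y in at x within {t..R}. p y = q y"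
          using order_tendstoD(2)[OF tendsto_ident_at \<open>x < R\<close>]
          by eventually_elim (simp add: q_def)
        ultimately show ?thesis by (rule Lim_transform_eventually)
      qed
    qed
  next
    fix x assume x: "x \<in> {t<..<R} - Y"
    have "(q has_real_derivative p' x) (at x)"
      by (rule has_field_derivative_transform_within_open[OF deriv[OF x], of "{..<R}"])
        (use x in \<open>auto simp: q_def\<close>)
    then show "(q has_vector_derivative p' x) (at x)"
      by (simp add: has_real_derivative_iff_has_vector_derivative)
  qed (use \<open>t < R\<close> in simp)
  then have "(p' has_integral l - p t) {t..R}"
    using \<open>t < R\<close> by (simp add: q_def)
  then have "(p' has_integral l - p t) {t<..<R}"
    by (simp add: has_integral_Icc_iff_Ioo)
  then show ?thesis
    using set_borel_integral_eq_integral(2)[OF int] by (simp add: integral_unique)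
qed

section \<open>The integral equation of the logarithmic derivative\<close>

text \<open>The integral equation forces \<open>f\<close> to be continuous on the whole interval and to solve the
  linear equation \<open>f' = (p' / p) f\<close> off the finite set \<open>Y\<close>.  As \<open>p\<close> solves the same equation,
  \<open>f / p\<close> has derivative \<open>0\<close> off \<open>Y\<close>, and continuity at the points of \<open>Y\<close> glues the constants on the
  components together.\<close>

lemma log_derivative_integral_equation_proportional:
  fixes p p' f :: "real \<Rightarrow> real" and Y :: "real set" and L R :: real
  defines "S \<equiv> {L<..<R} - Y"
  assumes "finite Y"
    and cont: "continuous_on {L<..<R} p" and pos: "\<And>x. x \<in> {L<..<R} \<Longrightarrow> 0 < p x"
    and deriv: "\<And>x. x \<in> S \<Longrightarrow> (p has_real_derivative p' x) (at x)"
    and cont': "continuous_on S p'"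
    and int: "set_integrable lborel {L<..<R} (\<lambda>x. p' x / p x * f x)"
    and eq: "\<And>t. t \<in> {L<..<R} \<Longrightarrow> f t = c - (LBINT x:{L<..<R} \<inter> {t<..}. p' x / p x * f x)"
  shows "\<exists>k. \<forall>t\<in>{L<..<R}. f t = k * p t"
proof -
  define g where "g x = p' x / p x * f x" for x
  have "open S"
    unfolding S_def using \<open>finite Y\<close> by (intro open_Diff finite_imp_closed) auto
  have gint: "set_integrable lborel T g" if "T \<subseteq> {L<..<R}" "T \<in> sets borel" for T
    using set_integrable_subset[OF int, of T] that by (simp add: g_def[abs_def])
  have HK: "g integrable_on {a..b}" and increment: "integral {a..b} g = f b - f a"
    if ab: "L < a" "a \<le> b" "b < R" for a b
  proof -
    let ?I = "{L<..<R}" and ?T = "{a<..b}"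
    have T: "?T \<subseteq> ?I" "?T \<in> sets borel"
      using ab by auto
    have B: "?I \<inter> {b<..} \<subseteq> ?I" "?I \<inter> {b<..} \<in> sets borel"
      by auto
    have neg: "negligible ({a..b} - ?T)" "negligible (?T - {a..b})"
      by (rule negligible_subset[of "{a}"]; auto)+
    note i = set_borel_integral_eq_integral[OF gint[OF T]]
    show "g integrable_on {a..b}"
      using i(1) by (rule integrable_spike_set) (use neg in \<open>auto elim: negligible_subset\<close>)
    have "?I \<inter> {a<..} = ?T \<union> (?I \<inter> {b<..})"
      using ab by auto
    moreover have "?T \<inter> (?I \<inter> {b<..}) = {}" by auto
    ultimately have "(LBINT x:?I \<inter> {a<..}. g x) = (LBINT x:?T. g x) + (LBINT x:?I \<inter> {b<..}. g x)"
      using set_integral_Un[OF _ gint[OF T] gint[OF B]] by simp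
    then have "(LBINT x:?T. g x) = f b - f a"
      using eq[of a] eq[of b] ab by (simp add: g_def)
    moreover have "integral ?T g = integral {a..b} g"
      by (rule integral_spike_set) (use neg in \<open>auto elim: negligible_subset\<close>)
    ultimately show "integral {a..b} g = f b - f a"
      using i(2) by simp
  qed
  \<comment> \<open>On compact subintervals \<open>f\<close> is an indefinite integral, hence continuous.  Only then is \<open>g\<close>
    known to be continuous on \<open>S\<close>, which makes \<open>f\<close> differentiable there.\<close>
  have f_cont: "continuous_on {a..b} f" if ab: "L < a" "a \<le> b" "b < R" for a b
  proof -
    have "continuous_on {a..b} (\<lambda>x. f a + integral {a..x} g)"
      by (intro continuous_intros indefinite_integral_continuous_1 HK ab)
    then show ?thesis
      by (rule continuous_on_eq) (use increment ab in auto)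
  qed
  have f_cont_I: "continuous_on {L<..<R} f"
    unfolding continuous_on_eq_continuous_at[OF open_greaterThanLessThan]
  proof
    fix x assume "x \<in> {L<..<R}"
    then obtain a b where "L < a" "a < x" "x < b" "b < R"
      using dense by (metis greaterThanLessThan_iff)
    then show "isCont f x"
      using continuous_on_interior[OF f_cont[of a b], of x] by simp
  qed
  have f_deriv: "(f has_real_derivative g x) (at x)" if x: "x \<in> S" for x
  proof -
    obtain a b where ab: "L < a" "a < x" "x < b" "b < R"
      using x dense unfolding S_def by (metis DiffD1 greaterThanLessThan_iff)
    have "continuous_on S g"
      unfolding g_def[abs_def]
      by (intro continuous_intros cont' continuous_on_subset[OF cont] continuous_on_subset[OF f_cont_I])
        (use pos in \<open>force simp: S_def\<close>)+
    then have "isCont g x"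
      using x \<open>open S\<close> by (simp add: continuous_on_eq_continuous_at)
    then have "((\<lambda>u. integral {a..u} g) has_vector_derivative g x) (at x within {a..b} - {})"
      using ab by (intro integral_has_vector_derivative_continuous_at HK)
        (auto intro: continuous_at_imp_continuous_at_within)
    then have "((\<lambda>u. integral {a..u} g) has_real_derivative g x) (at x)"
      using ab by (simp add: has_real_derivative_iff_has_vector_derivative at_within_Icc_at)
    then have "((\<lambda>u. f a + integral {a..u} g) has_real_derivative g x) (at x)"
      by (auto intro!: derivative_eq_intros)
    then show ?thesis
      by (rule has_field_derivative_transform_within_open[where S = "{a<..<b}"])
        (use ab increment in auto)
  qed
  have ratio: "f b / p b = f a / p a" if ab: "L < a" "a \<le> b" "b < R" for a b
  proof (rule has_derivative_zero_unique_strong_interval[where f = "\<lambda>x. f x / p x" and a = a and b = b])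
    show "finite Y" by fact
    have "\<forall>x\<in>{a..b}. p x \<noteq> 0"
      using pos ab by (metis atLeastAtMost_iff greaterThanLessThan_iff less_le_trans
          le_less_trans less_irrefl)
    then show "continuous_on {a..b} (\<lambda>x. f x / p x)"
      by (intro continuous_intros f_cont ab continuous_on_subset[OF cont]) (use ab in auto)
  next
    fix x assume "x \<in> {a..b} - Y"
    then have x: "x \<in> S" "0 < p x" using ab pos by (auto simp: S_def)
    have "((\<lambda>x. f x / p x) has_real_derivative 0) (at x)"
      using x by (auto intro!: derivative_eq_intros f_deriv deriv simp: g_def)
    then show "((\<lambda>x. f x / p x) has_derivative (\<lambda>h. 0)) (at x within {a..b})"
      by (auto simp: has_field_derivative_def lambda_zero intro: has_derivative_at_withinI)
  qed (use ab in auto)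
  show ?thesis
  proof (cases "L < R")
    case True
    define a where "a = (L + R) / 2"
    have a: "a \<in> {L<..<R}" using True by (simp add: a_def)
    have "f t = f a / p a * p t" if t: "t \<in> {L<..<R}" for t
    proof -
      have "f t / p t = f a / p a"
        using ratio[of a t] ratio[of t a] a t by (cases "a \<le> t") auto
      then show ?thesis
        using pos[OF t] by (simp add: field_simps)
    qed
    then show ?thesis by blast
  qed auto
qed

section \<open>Normalisation and the characterisation\<close>

text \<open>Outside \<open>A\<close> both densities vanish almost everywhere, so
  \<open>ennreal (f x) = ennreal k * ennreal (p x)\<close> holds almost everywhere, and comparing total masses
  gives \<open>ennreal k = 1\<close>.  Comparing in \<open>ennreal\<close> covers negative \<open>k\<close> without a separate case.\<close>

lemma density_proportional_to_prob_density:
  fixes X :: "'a \<Rightarrow> real"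
  assumes "prob_space M" and D: "has_lebesgue_density M X f"
    and A: "A \<in> sets borel" and XA: "\<And>\<omega>. \<omega> \<in> space M \<Longrightarrow> X \<omega> \<in> A"
    and p: "prob_density p" and pA: "AE x in lborel. p x \<noteq> 0 \<longrightarrow> x \<in> A"
    and scaled: "\<And>x. x \<in> A \<Longrightarrow> f x = k * p x"
  shows "has_lebesgue_density M X p"
proof -
  have f0: "0 \<le> f x" and D': "distributed M lborel X (\<lambda>x. ennreal (f x))" for x
    using D by (auto simp: has_lebesgue_density_def)
  have p0: "0 \<le> p x" and [measurable]: "p \<in> borel_measurable borel"
    and p1: "(\<integral>\<^sup>+x. ennreal (p x) \<partial>lborel) = 1" for x
    using p by (auto simp: prob_density_def)
  have fm: "(\<lambda>x. ennreal (f x)) \<in> borel_measurable lborel"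
    using distributed_borel_measurable[OF D'] .
  have "AE x in lborel. 0 < ennreal (f x) \<longrightarrow> x \<in> A"
    using distributed_AE_iff[OF D', of "\<lambda>x. x \<in> A"] A XA by simp
  with pA have ae: "AE x in lborel. ennreal (f x) = ennreal k * ennreal (p x)"
  proof eventually_elim
    case (elim x)
    show ?case
    proof (cases "x \<in> A")
      case True
      then show ?thesis using scaled p0 by (simp add: ennreal_mult'')
    next
      case False
      then show ?thesis using elim f0[of x] by (auto simp: ennreal_eq_0_iff)
    qed
  qed
  have "1 = emeasure M (X -` space lborel \<inter> space M)"
    using prob_space.emeasure_space_1[OF \<open>prob_space M\<close>] by simp
  also have "\<dots> = (\<integral>\<^sup>+x. ennreal (f x) \<partial>lborel)"
    using distributed_emeasure[OF D', of "space lborel"] by simp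
  also have "\<dots> = (\<integral>\<^sup>+x. ennreal k * ennreal (p x) \<partial>lborel)"
    by (rule nn_integral_cong_AE[OF ae])
  also have "\<dots> = ennreal k"
    by (simp add: nn_integral_cmult p1)
  finally have "ennreal k = 1" by simp
  then have "density lborel (\<lambda>x. ennreal (f x)) = density lborel (\<lambda>x. ennreal (p x))"
    using ae by (intro density_cong fm) auto
  then show ?thesis
    using D' p0 by (simp add: has_lebesgue_density_def distributed_def)
qed

theorem lemma6p1:
  fixes M :: "'a measure" and X :: "'a \<Rightarrow> real"
    and p :: "real \<Rightarrow> real" and L R :: real and Y S :: "real set" and P :: "real \<Rightarrow> real"
  defines "P \<equiv> dist_fun p L"
    and "S \<equiv> {L<..<R} - Y"
  assumes "L < R"
    and "prob_density p"
    and "dens_support p = {L..R}"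
    and i_cont: "continuous_on {L<..<R} p"
    and i_pos: "\<forall>x\<in>{L<..<R}. 0 < p x"
    and i_points: "finite Y" "Y \<subseteq> {L<..<R}"
    and i_diff: "\<forall>x\<in>S. p differentiable (at x)" "continuous_on S (deriv p)"
    and ii: "bdd_above ((\<lambda>x. \<bar>deriv p x * min (P x) (1 - P x) / (p x)\<^sup>2\<bar>) ` S)"
    and iii: "set_integrable lborel S (\<lambda>x. (1 + \<bar>x\<bar>) * \<bar>deriv p x\<bar>)"
    and iv: "((\<lambda>x. P x / p x) \<longlongrightarrow> 0) (at_right L)"
    and v: "((\<lambda>x. (1 - P x) / p x) \<longlongrightarrow> 0) (at_left R)"
    and lim_exists: "\<exists>l::real. (p \<longlongrightarrow> l) (at_left R)"
    and "prob_space M"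
    and "X \<in> borel_measurable M"
    and "\<forall>\<omega>\<in>space M. X \<omega> \<in> {L<..<R}"
    and "\<exists>f. has_lebesgue_density M X f"
    and "integrable M (\<lambda>\<omega>. \<bar>deriv p (X \<omega>) / p (X \<omega>)\<bar>)"
  shows "has_lebesgue_density M X p \<longleftrightarrow>
    (\<exists>f. has_lebesgue_density M X f \<and>
       (\<forall>t\<in>{L<..<R}. f t =
          (\<integral>\<omega>. - (deriv p (X \<omega>) / p (X \<omega>)) * indicator {t<..} (X \<omega>) \<partial>M) + Lim (at_left R) p))"
proof -
  have i_open: "open S"
    unfolding S_def using i_points by (intro open_Diff finite_imp_closed) auto
  then have S_borel: "S \<in> sets borel" by simp
  have deriv: "(p has_real_derivative deriv p x) (at x)" if "x \<in> S" for x
    using i_diff(1) that by (simp add: DERIV_deriv_iff_real_differentiable)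
  have r_cont: "continuous_on S (\<lambda>x. deriv p x / p x)"
    by (intro continuous_intros i_diff(2) continuous_on_subset[OF i_cont])
      (use i_pos in \<open>force simp: S_def\<close>)+
  obtain l where l: "(p \<longlongrightarrow> l) (at_left R)" using lim_exists by blast
  then have Lim_l: "Lim (at_left R) p = l" by (intro tendsto_Lim) simp_all
  let ?I = "{L<..<R}"
  \<comment> \<open>The values of \<open>deriv p\<close> on \<open>Y\<close> are arbitrary, but changing a function at finitely many points
    keeps it Borel measurable.\<close>
  have r_meas: "(\<lambda>x. indicator ?I x * (deriv p x / p x)) \<in> borel_measurable borel"
  proof (rule measurable_discrete_difference[where X = Y])
    show "(\<lambda>x. indicator S x *\<^sub>R (deriv p x / p x)) \<in> borel_measurable borel"
      by (rule borel_measurable_continuous_on_indicator[OF S_borel r_cont])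
    show "countable Y" by (rule countable_finite) fact
  qed (auto simp: S_def indicator_def)
  have int_I: "set_integrable lborel ?I (\<lambda>x. deriv p x / p x * f x)"
    and expectation: "(\<integral>\<omega>. - (deriv p (X \<omega>) / p (X \<omega>)) * indicator {t<..} (X \<omega>) \<partial>M)
      = - (LBINT x:?I \<inter> {t<..}. deriv p x / p x * f x)"
    if "has_lebesgue_density M X f" for f t
    using set_integrable_times_density[OF that _ _ r_meas]
      expectation_beyond_eq_integral[OF that _ _ r_meas] assms by auto
  show ?thesis
  proof
    assume Dp: "has_lebesgue_density M X p"
    have "p t = (\<integral>\<omega>. - (deriv p (X \<omega>) / p (X \<omega>)) * indicator {t<..} (X \<omega>) \<partial>M) + Lim (at_left R) p"
      if t: "t \<in> {L<..<R}" for t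
    proof -
      have T: "?I \<inter> {t<..} = {t<..<R}" using t by auto
      have cancel: "deriv p x / p x * p x = deriv p x" if "x \<in> ?I" for x
        using that i_pos by force
      have "set_integrable lborel ?I (deriv p)"
        using int_I[OF Dp] by (rule iffD1[OF set_integrable_cong[OF refl refl cancel], rotated])
      then have int_t: "set_integrable lborel {t<..<R} (deriv p)"
        by (rule set_integrable_subset) (use t in auto)
      have "(LBINT x:{t<..<R}. deriv p x) = l - p t"
      proof (rule integral_deriv_eq_left_limit_diff[OF i_points(1) _ _ _ l int_t])
        show "continuous_on {t..<R} p"
          by (rule continuous_on_subset[OF i_cont]) (use t in auto)
        show "(p has_real_derivative deriv p x) (at x)" if "x \<in> {t<..<R} - Y" for x
          by (rule deriv) (use that t in \<open>auto simp: S_def\<close>)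
      qed (use t in simp)
      moreover have "(LBINT x:{t<..<R}. deriv p x / p x * p x) = (LBINT x:{t<..<R}. deriv p x)"
        using cancel t by (intro set_lebesgue_integral_cong) auto
      ultimately show ?thesis
        unfolding expectation[OF Dp] T Lim_l by simp
    qed
    with Dp show "\<exists>f. has_lebesgue_density M X f \<and> (\<forall>t\<in>{L<..<R}. f t =
        (\<integral>\<omega>. - (deriv p (X \<omega>) / p (X \<omega>)) * indicator {t<..} (X \<omega>) \<partial>M) + Lim (at_left R) p)"
      by blast
  next
    assume "\<exists>f. has_lebesgue_density M X f \<and> (\<forall>t\<in>{L<..<R}. f t =
        (\<integral>\<omega>. - (deriv p (X \<omega>) / p (X \<omega>)) * indicator {t<..} (X \<omega>) \<partial>M) + Lim (at_left R) p)"
    then obtain f where Df: "has_lebesgue_density M X f"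
      and f: "\<And>t. t \<in> {L<..<R} \<Longrightarrow> f t =
        (\<integral>\<omega>. - (deriv p (X \<omega>) / p (X \<omega>)) * indicator {t<..} (X \<omega>) \<partial>M) + Lim (at_left R) p"
      by blast
    have "f t = l - (LBINT x:?I \<inter> {t<..}. deriv p x / p x * f x)" if "t \<in> {L<..<R}" for t
      using f[OF that] unfolding expectation[OF Df] Lim_l by simp
    then obtain k where k: "\<And>t. t \<in> {L<..<R} \<Longrightarrow> f t = k * p t"
      using log_derivative_integral_equation_proportional[of Y L R p "deriv p" f l]
        i_points i_cont i_pos deriv i_diff(2) int_I[OF Df]
      unfolding S_def by blast
    have p_supp: "AE x in lborel. p x \<noteq> 0 \<longrightarrow> x \<in> {L<..<R}"
    proof -
      \<comment> \<open>The density may be nonzero at \<open>L\<close> and \<open>R\<close> themselves, which are null.\<close>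
      have outside: "p x = 0" if "x \<notin> {L..R}" for x
        using assms(5) that closure_subset[of "{x. p x \<noteq> 0}"] by (auto simp: dens_support_def)
      show ?thesis
        using AE_lborel_singleton[of L] AE_lborel_singleton[of R]
      proof eventually_elim
        case (elim x)
        then show ?case using outside[of x] by (cases "x \<in> {L..R}") auto
      qed
    qed
    show "has_lebesgue_density M X p"
      by (rule density_proportional_to_prob_density[OF _ Df _ _ _ p_supp k]) (use assms in auto)
  qed
qed

end
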